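(* Let $P\subseteq\mathbb{R}^n$ be a polytope and let $f$ be a convex function, differentiable on a domain containing $P$, that is smooth with curvature at most $C$. Let $x^*$ be a minimum point of $f$ over $P$. Fix an accuracy $K\ge 1$, a start vertex $x_1$ of $P$, and $\Phi_0>0$ with $f(x_1)-f(x^* )\le \Phi_0$. Run the Lazy Conditional Gradient algorithm (described in the context) with step sizes $$\gamma_t=\frac{2(K^2+1)}{K(t+K^2+2)}.$$ Then for every iterate $x_t$ produced by the algorithm, $$f(x_t)-f(x^* )\le \frac{2\max\{C,\Phi_0\}(K^2+1)}{t+K^2+2}.$$
   Context: Gradients act on vectors by the standard inner product, i.e. $\nabla f(x)(y-x)=\langle \nabla f(x),y-x\rangle$. A convex function $f$ is smooth with curvature at most $C$ if $f(\gamma y+(1-\gamma)x)\le f(x)+\gamma\nabla f(x)(y-x)+C\gamma^2/2$ for all $x,y$ in its domain and all $0\le\gamma\le1$. Weak separation oracle $\mathrm{LPsep}_P(c,x,\Phi,K)$: given $c\in\mathbb{R}^n$, a point $x\in P$, $\Phi>0$ and $K\ge1$, it returns either (1) a vertex $y$ of $P$ with $c(x-y)>\Phi/K$, or (2) the answer false, and it may return false only if $c(x-z)\le\Phi$ for all $z\in P$. (If both cases apply, either answer may be returned.) Lazy Conditional Gradient algorithm: given $f$, $C$, $x_1$, the oracle, $K$, step sizes $\gamma_t$ and $\Phi_0$, for $t=1,\dots,T-1$: set $\Phi_t=\dfrac{\Phi_{t-1}+C\gamma_t^2/2}{1+\gamma_t/K}$; set $v_t=\mathrm{LPsep}_P(\nabla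 f(x_t),x_t,\Phi_t,K)$; if $v_t$ is false put $x_{t+1}=x_t$, otherwise put $x_{t+1}=(1-\gamma_t)x_t+\gamma_t v_t$. *)

theory Defs
  imports "HOL-Analysis.Analysis"
begin

text \<open>The library's \<open>GDERIV\<close> is relative to a full neighbourhood. Here derivatives are taken
  within the domain \<open>D\<close>, as in \<^const>\<open>differentiable_on\<close>; for open \<open>D\<close> the two notions agree.\<close>

definition gradient_on :: "('a::real_inner \<Rightarrow> real) \<Rightarrow> ('a \<Rightarrow> 'a) \<Rightarrow> 'a set \<Rightarrow> bool" where
  "gradient_on f g D \<longleftrightarrow> (\<forall>x\<in>D. (f has_derivative (\<lambda>h. g x \<bullet> h)) (at x within D))"

definition curvature_at_most ::
    "('a::real_inner \<Rightarrow> real) \<Rightarrow> ('a \<Rightarrow> 'a) \<Rightarrow> 'a set \<Rightarrow> real \<Rightarrow> bool" where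
  "curvature_at_most f g D C \<longleftrightarrow>
     (\<forall>x\<in>D. \<forall>y\<in>D. \<forall>\<gamma>\<in>{0..1}.
        f (\<gamma> *\<^sub>R y + (1 - \<gamma>) *\<^sub>R x) \<le> f x + \<gamma> * (g x \<bullet> (y - x)) + C * \<gamma>\<^sup>2 / 2)"

text \<open>\<open>LPsep_answer P c x \<Phi> K r\<close>: the oracle may answer \<open>r\<close> on the given input, where \<^const>\<open>None\<close>
  encodes the answer ``false''. It is a relation because the answer need not be determined by the
  input. Nothing is promised on inputs violating the oracle's preconditions.\<close>

definition LPsep_answer ::
    "'a::real_inner set \<Rightarrow> 'a \<Rightarrow> 'a \<Rightarrow> real \<Rightarrow> real \<Rightarrow> 'a option \<Rightarrow> bool" where
  "LPsep_answer P c x \<Phi> K r \<longleftrightarrow>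
     (x \<in> P \<and> \<Phi> > 0 \<and> K \<ge> 1 \<longrightarrow>
        (case r of
           Some y \<Rightarrow> y extreme_point_of P \<and> c \<bullet> (x - y) > \<Phi> / K
         | None \<Rightarrow> (\<forall>z\<in>P. c \<bullet> (x - z) \<le> \<Phi>)))"

text \<open>The sequences \<open>\<Phi>\<close>, \<open>v\<close>, \<open>x\<close> are constrained only as far as a run producing the iterates
  \<open>x 1, \<dots>, x T\<close> determines them.\<close>

definition lazy_cg_run ::
    "'a::real_inner set \<Rightarrow> ('a \<Rightarrow> 'a) \<Rightarrow> real \<Rightarrow> 'a \<Rightarrow> real \<Rightarrow> (nat \<Rightarrow> real) \<Rightarrow> real \<Rightarrow> nat \<Rightarrow>
     (nat \<Rightarrow> real) \<Rightarrow> (nat \<Rightarrow> 'a option) \<Rightarrow> (nat \<Rightarrow> 'a) \<Rightarrow> bool" where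
  "lazy_cg_run P g C x\<^sub>1 K \<gamma> \<Phi>\<^sub>0 T \<Phi> v x \<longleftrightarrow>
     \<Phi> 0 = \<Phi>\<^sub>0 \<and> x 1 = x\<^sub>1 \<and>
     (\<forall>t\<in>{1..<T}.
        \<Phi> t = (\<Phi> (t - 1) + C * (\<gamma> t)\<^sup>2 / 2) / (1 + \<gamma> t / K) \<and>
        LPsep_answer P (g (x t)) (x t) (\<Phi> t) K (v t) \<and>
        x (t + 1) = (case v t of None \<Rightarrow> x t | Some y \<Rightarrow> (1 - \<gamma> t) *\<^sub>R x t + \<gamma> t *\<^sub>R y))"

end

theory Submission imports Defs begin

text \<open>The parameter \<open>\<Phi> (t - 1)\<close> bounds the primal gap of the \<open>t\<close>-th iterate. If the oracle
  answers false, then \<open>\<Phi> t\<close> bounds the Frank-Wolfe gap and hence, by convexity, the primal gap;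
  otherwise the curvature bound gives a progress of \<open>\<gamma> t * \<Phi> t / K - C * (\<gamma> t)\<^sup>2 / 2\<close>, and the
  update rule for \<open>\<Phi>\<close> is chosen so that the new gap is again at most \<open>\<Phi> t\<close>. It remains to solve
  the scalar recursion for \<open>\<Phi>\<close>.\<close>

text \<open>The derivative is taken only within \<open>D\<close>, so \<open>f\<close> is restricted
  to the segment \<open>p\<close> from \<open>x\<close> to \<open>z\<close>, which convexity keeps
  inside \<open>D\<close>. By convexity each difference quotient at \<open>0\<close> along
  \<open>p\<close> is at most \<open>f z - f x\<close>, and so is its one-sided limit, the
  directional derivative.\<close>

lemma gradient_on_above_tangent:
  assumes conv: "convex_on D f" and grad: "gradient_on f g D" and x: "x \<in> D" and z: "z \<in> D"
  shows "f x + g x \<bullet> (z - x) \<le> f z"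
proof -
  define p where "p h = x + h *\<^sub>R (z - x)" for h :: real
  have p_eq: "p h = (1 - h) *\<^sub>R x + h *\<^sub>R z" for h
    by (simp add: p_def algebra_simps)
  have p_in: "p ` {0..1} \<subseteq> D"
    using convexD[OF convex_on_imp_convex[OF conv] x z] by (auto simp: p_eq)
  have "(p has_derivative (\<lambda>h. h *\<^sub>R (z - x))) (at 0 within {0..1})"
    unfolding p_def by (auto intro!: derivative_eq_intros)
  moreover have "(f has_derivative (\<lambda>h. g x \<bullet> h)) (at (p 0) within p ` {0..1})"
    using grad x p_in by (auto simp: gradient_on_def p_def intro: has_derivative_subset)
  ultimately have "((\<lambda>h. f (p h)) has_derivative (\<lambda>h. g x \<bullet> (h *\<^sub>R (z - x)))) (at 0 within {0..1})"
    by (rule has_derivative_in_compose)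
  then have "((\<lambda>h. f (p h)) has_field_derivative g x \<bullet> (z - x)) (at 0 within {0..1})"
    by (simp add: has_field_derivative_def mult_commute_abs)
  then have "((\<lambda>h. (f (p h) - f x) / h) \<longlongrightarrow> g x \<bullet> (z - x)) (at 0 within {0..1})"
    by (simp add: has_field_derivative_iff p_def)
  moreover have "\<forall>\<^sub>F h in at 0 within {0..1}. (f (p h) - f x) / h \<le> f z - f x"
  proof -
    have "(f (p h) - f x) / h \<le> f z - f x" if "h \<in> {0..1}" "h \<noteq> 0" for h
      using convex_onD[OF conv, of h x z] that x z by (simp add: p_eq field_simps)
    then show ?thesis
      by (simp add: eventually_at_filter)
  qed
  moreover have "at 0 within {0..1} \<noteq> (bot :: real filter)"
    by (simp add: trivial_limit_within islimpt_Icc)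
  ultimately have "g x \<bullet> (z - x) \<le> f z - f x"
    by (intro tendsto_upperbound)
  then show ?thesis by simp
qed

text \<open>With both points equal to \<open>x\<close> and step 1, the curvature inequality
  collapses to \<open>0 \<le> C / 2\<close>.\<close>

lemma curvature_at_most_nonneg:
  assumes "curvature_at_most f g D C" and "x \<in> D"
  shows "0 \<le> C"
proof -
  have "f (1 *\<^sub>R x + (1 - 1) *\<^sub>R x) \<le> f x + 1 * (g x \<bullet> (x - x)) + C * 1\<^sup>2 / 2"
    using assms unfolding curvature_at_most_def by (metis atLeastAtMost_iff order_refl zero_le_one)
  then show ?thesis by simp
qed

text \<open>These bounds make each update a convex combination and bring its step within the range
  of the curvature inequality.\<close>

lemma lazy_cg_step_size_bounds:
  fixes K s :: real
  assumes "1 \<le> K" and "1 \<le> s"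
  shows "0 < 2 * (K\<^sup>2 + 1) / (K * (s + K\<^sup>2 + 2))"
    and "2 * (K\<^sup>2 + 1) / (K * (s + K\<^sup>2 + 2)) \<le> 1"
proof -
  have pos: "0 < K * (s + K\<^sup>2 + 2)" "0 < 2 * (K\<^sup>2 + 1)"
    using assms by (auto intro!: mult_pos_pos add_nonneg_pos add_pos_nonneg)
  then show "0 < 2 * (K\<^sup>2 + 1) / (K * (s + K\<^sup>2 + 2))" by (rule divide_pos_pos[rotated])
  \<comment> \<open>This product is the factored difference of the two sides of the next inequality,
    the case \<open>s = 1\<close>.\<close>
  have "0 \<le> (K - 1) * ((K - 1) * K + 2)"
    using assms by simp
  then have "2 * (K\<^sup>2 + 1) \<le> K * (1 + K\<^sup>2 + 2)"
    by (simp add: algebra_simps power2_eq_square)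
  also have "\<dots> \<le> K * (s + K\<^sup>2 + 2)"
    using assms by (intro mult_left_mono) auto
  finally show "2 * (K\<^sup>2 + 1) / (K * (s + K\<^sup>2 + 2)) \<le> 1"
    using pos by simp
qed

text \<open>One step of the rate: \<open>s\<close> stands for \<open>t + K\<^sup>2 + 2\<close>,
  which is at least \<open>a\<close>, and \<open>M\<close> for a common bound on \<open>C\<close>
  and the initial \<open>\<Phi>\<close>.\<close>

lemma lazy_cg_recursion_step:
  fixes K M s C \<gamma> \<phi> :: real
  defines "a \<equiv> K\<^sup>2 + 1"
  assumes "1 \<le> K" and "a \<le> s" and "C \<le> M" and "0 \<le> M"
    and \<gamma>: "\<gamma> = 2 * a / (K * s)" and \<phi>: "\<phi> \<le> 2 * M * a / s"
  shows "(\<phi> + C * \<gamma>\<^sup>2 / 2) / (1 + \<gamma> / K) \<le> 2 * M * a / (s + 1)"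
proof -
  have a: "1 \<le> a" by (simp add: a_def)
  with assms have s: "0 < s" by linarith
  have K: "0 < K" using assms by simp
  have "0 \<le> \<gamma>" unfolding \<gamma> using a s K by simp
  then have pos: "0 < 1 + \<gamma> / K" using K by (simp add: add_pos_nonneg)
  \<comment> \<open>Since \<open>a = K\<^sup>2 + 1\<close>, right side minus left side is exactly
    \<open>s - a\<close>.\<close>
  have "(s + 1) * (K\<^sup>2 * s + a) \<le> s * (K\<^sup>2 * s + 2 * a)"
    using \<open>a \<le> s\<close> by (simp add: a_def algebra_simps power2_eq_square)
  then have "(s + 1) * (K\<^sup>2 * s + a) / (s * (s + 1) * (K\<^sup>2 * s))
      \<le> s * (K\<^sup>2 * s + 2 * a) / (s * (s + 1) * (K\<^sup>2 * s))"
    using s K by (intro divide_right_mono) auto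
  then have key: "1 / s * (1 + a / (K\<^sup>2 * s)) \<le> 1 / (s + 1) * (1 + 2 * a / (K\<^sup>2 * s))"
    using s K by (simp add: divide_simps) (simp add: algebra_simps)?
  have "\<phi> + C * \<gamma>\<^sup>2 / 2 \<le> 2 * M * a / s + M * \<gamma>\<^sup>2 / 2"
    using \<phi> \<open>C \<le> M\<close> by (intro add_mono divide_right_mono mult_right_mono) auto
  \<comment> \<open>The choice of \<open>\<gamma>\<close> makes
    \<open>M * \<gamma>\<^sup>2 / 2\<close> equal to \<open>2 * M * a / s\<close> times
    \<open>a / (K\<^sup>2 * s)\<close>, and \<open>\<gamma> / K\<close> equal to twice that last
    factor.\<close>
  also have "\<dots> = 2 * M * a * (1 / s * (1 + a / (K\<^sup>2 * s)))"
    unfolding \<gamma> using s K by (simp add: field_simps power2_eq_square)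
  also have "\<dots> \<le> 2 * M * a * (1 / (s + 1) * (1 + 2 * a / (K\<^sup>2 * s)))"
    using key a \<open>0 \<le> M\<close> by (intro mult_left_mono) auto
  also have "\<dots> = 2 * M * a / (s + 1) * (1 + \<gamma> / K)"
    unfolding \<gamma> by (simp add: power2_eq_square mult.assoc mult.left_commute)
  finally show ?thesis
    using pos by (simp add: pos_divide_le_eq)
qed

text \<open>Membership in \<open>P\<close> and positivity of \<open>\<Phi>\<close> are carried along
  with the gap bound because the oracle promises something only under these preconditions. The index
  is shifted: the step from \<open>x t\<close> uses \<open>\<Phi> t\<close>, so the gap known
  beforehand is \<open>\<Phi> (t - 1)\<close>.\<close>

lemma lazy_cg_invariant:
  fixes f :: "'a::real_inner \<Rightarrow> real"
  assumes "convex P" and "P \<subseteq> D" and conv: "convex_on D f" and grad: "gradient_on f g D"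
    and curv: "curvature_at_most f g D C" and xmin: "xmin \<in> P"
    and "1 \<le> K" and "x\<^sub>1 \<in> P" and "0 < \<Phi>\<^sub>0" and "f x\<^sub>1 - f xmin \<le> \<Phi>\<^sub>0"
    and \<gamma>: "\<And>s. 1 \<le> s \<Longrightarrow> 0 < \<gamma> s \<and> \<gamma> s \<le> 1"
    and run: "lazy_cg_run P g C x\<^sub>1 K \<gamma> \<Phi>\<^sub>0 T \<Phi> v x"
    and "1 \<le> t" and "t \<le> T"
  shows "x t \<in> P \<and> 0 < \<Phi> (t - 1) \<and> f (x t) - f xmin \<le> \<Phi> (t - 1)"
  using \<open>1 \<le> t\<close> \<open>t \<le> T\<close>
proof (induction t rule: dec_induct)
  case base
  then show ?case using run assms by (simp add: lazy_cg_run_def)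
next
  case (step t)
  then have xP: "x t \<in> P" and \<Phi>_pos: "0 < \<Phi> (t - 1)" and gap: "f (x t) - f xmin \<le> \<Phi> (t - 1)"
    by auto
  have xD: "x t \<in> D" using xP \<open>P \<subseteq> D\<close> by auto
  have "t \<in> {1..<T}" using step by simp
  then have \<Phi>: "\<Phi> t = (\<Phi> (t - 1) + C * (\<gamma> t)\<^sup>2 / 2) / (1 + \<gamma> t / K)"
    and answer: "LPsep_answer P (g (x t)) (x t) (\<Phi> t) K (v t)"
    and next_x: "x (Suc t) = (case v t of None \<Rightarrow> x t | Some y \<Rightarrow> (1 - \<gamma> t) *\<^sub>R x t + \<gamma> t *\<^sub>R y)"
    using run unfolding lazy_cg_run_def Suc_eq_plus1 by blast+
  have \<gamma>t: "0 < \<gamma> t" "\<gamma> t \<le> 1" using \<gamma> step by auto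
  have "0 < 1 + \<gamma> t / K" using \<gamma>t \<open>1 \<le> K\<close> by (simp add: add_pos_nonneg)
  moreover have "0 < \<Phi> (t - 1) + C * (\<gamma> t)\<^sup>2 / 2"
    using \<Phi>_pos curvature_at_most_nonneg[OF curv xD] by (simp add: add_pos_nonneg)
  \<comment> \<open>Cleared of its denominator, the update rule says that the old bound, minus the
    guaranteed progress \<open>\<gamma> t * \<Phi> t / K\<close>, plus the curvature error, is
    exactly \<open>\<Phi> t\<close>.\<close>
  ultimately have \<Phi>t: "0 < \<Phi> t" "\<Phi> t * (1 + \<gamma> t / K) = \<Phi> (t - 1) + C * (\<gamma> t)\<^sup>2 / 2"
    by (simp_all add: \<Phi>)
  show ?case
  proof (cases "v t")
    case None
    then have "g (x t) \<bullet> (x t - xmin) \<le> \<Phi> t"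
      using answer xP \<Phi>t \<open>1 \<le> K\<close> xmin by (simp add: LPsep_answer_def)
    moreover have "f (x t) + g (x t) \<bullet> (xmin - x t) \<le> f xmin"
      using gradient_on_above_tangent[OF conv grad xD] xmin \<open>P \<subseteq> D\<close> by auto
    ultimately show ?thesis
      using xP \<Phi>t None next_x by (simp add: inner_diff_right)
  next
    case (Some y)
    then have "y extreme_point_of P" and progress: "\<Phi> t / K < g (x t) \<bullet> (x t - y)"
      using answer xP \<Phi>t \<open>1 \<le> K\<close> by (simp_all add: LPsep_answer_def)
    then have yP: "y \<in> P" by (simp add: extreme_point_of_def)
    have x_eq: "x (Suc t) = \<gamma> t *\<^sub>R y + (1 - \<gamma> t) *\<^sub>R x t"
      using Some next_x by simp
    then have "x (Suc t) \<in> P"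
      using convexD[OF \<open>convex P\<close> yP xP] \<gamma>t by simp
    have "f (x (Suc t)) \<le> f (x t) + \<gamma> t * (g (x t) \<bullet> (y - x t)) + C * (\<gamma> t)\<^sup>2 / 2"
      using curv xD yP \<open>P \<subseteq> D\<close> \<gamma>t unfolding x_eq curvature_at_most_def by auto
    moreover have "\<gamma> t * (\<Phi> t / K) \<le> \<gamma> t * (g (x t) \<bullet> (x t - y))"
      using progress \<gamma>t by (intro mult_left_mono) auto
    ultimately have "f (x (Suc t)) - f xmin \<le> \<Phi> t"
      using gap \<Phi>t(2) by (simp add: inner_diff_right algebra_simps)
    with \<open>x (Suc t) \<in> P\<close> \<Phi>t show ?thesis by simp
  qed
qed

text \<open>The constant \<open>M\<close> has to dominate both \<open>\<Phi> 0\<close>, for the base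
  case, and \<open>C\<close>, for the induction step; this is where the maximum in the final bound
  comes from.\<close>

lemma lazy_cg_recursion_bound:
  fixes K M C :: real
  assumes "1 \<le> K" and "C \<le> M" and "\<Phi> 0 \<le> M" and "0 \<le> M"
    and \<gamma>: "\<And>s. 1 \<le> s \<Longrightarrow> \<gamma> s = 2 * (K\<^sup>2 + 1) / (K * (real s + K\<^sup>2 + 2))"
    and \<Phi>: "\<And>t. 1 \<le> t \<Longrightarrow> t < T \<Longrightarrow> \<Phi> t = (\<Phi> (t - 1) + C * (\<gamma> t)\<^sup>2 / 2) / (1 + \<gamma> t / K)"
    and "1 \<le> t" and "t \<le> T"
  shows "\<Phi> (t - 1) \<le> 2 * M * (K\<^sup>2 + 1) / (real t + K\<^sup>2 + 2)"
  using \<open>1 \<le> t\<close> \<open>t \<le> T\<close>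
proof (induction t rule: dec_induct)
  case base
  \<comment> \<open>At \<open>t = 1\<close> the denominator is \<open>K\<^sup>2 + 3\<close>, and it
    is at most \<open>2 * (K\<^sup>2 + 1)\<close> because \<open>K\<^sup>2\<close> is at least
    1.\<close>
  have "M * (K\<^sup>2 + 3) \<le> M * (2 * (K\<^sup>2 + 1))"
    using \<open>1 \<le> K\<close> \<open>0 \<le> M\<close> one_le_power[of K 2] by (intro mult_left_mono) auto
  moreover have "0 < K\<^sup>2 + 3" by (simp add: add_nonneg_pos)
  ultimately have "M \<le> 2 * M * (K\<^sup>2 + 1) / (K\<^sup>2 + 3)"
    by (simp add: pos_le_divide_eq mult.assoc mult.left_commute)
  then show ?case using \<open>\<Phi> 0 \<le> M\<close> by (simp add: add.commute)
next
  case (step t)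
  have "(\<Phi> (t - 1) + C * (\<gamma> t)\<^sup>2 / 2) / (1 + \<gamma> t / K)
      \<le> 2 * M * (K\<^sup>2 + 1) / ((real t + K\<^sup>2 + 2) + 1)"
    using step assms by (intro lazy_cg_recursion_step) auto
  then show ?case using \<Phi>[of t] step by (simp add: algebra_simps)
qed

theorem theorem3p1:
  fixes P D :: "(real ^ 'n) set"
    and f :: "real ^ 'n \<Rightarrow> real"
    and grad :: "real ^ 'n \<Rightarrow> real ^ 'n"
    and C K \<Phi>\<^sub>0 :: real
    and xmin x\<^sub>1 :: "real ^ 'n"
    and \<gamma> \<Phi> :: "nat \<Rightarrow> real"
    and v :: "nat \<Rightarrow> (real ^ 'n) option"
    and x :: "nat \<Rightarrow> real ^ 'n"
    and T t :: nat
  assumes "polytope P" and "P \<subseteq> D"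
    and "convex_on D f"
    and "gradient_on f grad D"
    and "curvature_at_most f grad D C"
    and "is_arg_min f (\<lambda>z. z \<in> P) xmin"
    and "K \<ge> 1"
    and "x\<^sub>1 extreme_point_of P"
    and "\<Phi>\<^sub>0 > 0" and "f x\<^sub>1 - f xmin \<le> \<Phi>\<^sub>0"
    and "\<And>s. s \<ge> 1 \<Longrightarrow> \<gamma> s = 2 * (K\<^sup>2 + 1) / (K * (real s + K\<^sup>2 + 2))"
    and "lazy_cg_run P grad C x\<^sub>1 K \<gamma> \<Phi>\<^sub>0 T \<Phi> v x"
    and "1 \<le> t" and "t \<le> T"
  shows "f (x t) - f xmin \<le> 2 * max C \<Phi>\<^sub>0 * (K\<^sup>2 + 1) / (real t + K\<^sup>2 + 2)"
proof -
  have "0 < \<gamma> s \<and> \<gamma> s \<le> 1" if "1 \<le> s" for s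
    using lazy_cg_step_size_bounds[OF \<open>K \<ge> 1\<close>, of "real s"] assms(11)[OF that] that by simp
  moreover have "xmin \<in> P" "x\<^sub>1 \<in> P"
    using assms by (auto simp: is_arg_min_def extreme_point_of_def)
  ultimately have "f (x t) - f xmin \<le> \<Phi> (t - 1)"
    using lazy_cg_invariant[OF polytope_imp_convex] assms by blast
  also have "\<dots> \<le> 2 * max C \<Phi>\<^sub>0 * (K\<^sup>2 + 1) / (real t + K\<^sup>2 + 2)"
    \<comment> \<open>Here \<open>M\<close> is \<open>max C \<Phi>\<^sub>0\<close>, nonnegative
      since \<open>\<Phi>\<^sub>0\<close> is positive. The instantiated variables do not occur in
      the conclusion of the rule, so unification with the goal would leave them open.\<close>
    using assms by (intro lazy_cg_recursion_bound[where C = C and T = T and \<gamma> = \<gamma>])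
      (auto simp: lazy_cg_run_def)
  finally show ?thesis .
qed

end
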